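(* Let $K$ be a martingale kernel on $(0,\infty)$ and, for $x>0$, let $S=(S_k)_{k\in\mathbb{N}_0}$ be under $\mathbb{P}_x$ the positive Markov martingale with transition kernel $K$ started from $S_0=x$. Let $a(x):=\mathbb{P}_x[S_1<x]=K(x,(0,x))$ and suppose that for every $x_a>0$ and every $y>x_a$ one has $\inf_{x\in[x_a,y]}a(x)>0$. Then the default function $M_S$ of $S$ is the maximal solution to $$M(x)=\int_{[x,\infty)}M(y)\,K(x,\mathrm{d}y),\quad x>0,$$ among Borel-measurable functions $M:(0,\infty)\to[0,\infty)$ dominated by the identity. It is given by $M_S=\mathcal{K}^\infty(\mathrm{id})$. Moreover, $M_S(x)<x$ for all $x>0$, and if $M_S\ne0$ (i.e. $M_S$ is not identically zero), then $$\limsup_{x\to\infty}\frac{M_S(x)}{x}=1.$$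
   Context: Martingale kernel: $K:(0,\infty)\times\mathcal{B}_{(0,\infty)}\to[0,\infty)$ is a Markov (probability) kernel on $(0,\infty)$ with $\int_{(0,\infty)}y\,K(x,\mathrm{d}y)=x$ for all $x>0$. For $x>0$, under $\mathbb{P}_x$ (with expectation $\mathbb{E}_x$) the process $S=(S_k)_{k\in\mathbb{N}_0}$ is the time-homogeneous Markov chain with $S_0=x$ and transition kernel $K$; it is a positive martingale, with $\mathbb{P}_x$-a.s. limit $S_\infty$. Default function: $M_S:(0,\infty)\to[0,\infty)$, $M_S(x):=\lim_{n\to\infty}\mathbb{E}_x\big[(S_n-S_\infty)\mathbf{1}_{\{S_n\ge S_{n-1}\ge\dots\ge S_1\ge x\}}\big]$. $\mathcal{I}$ is the set of Borel-measurable $M:(0,\infty)\to[0,\infty)$ with $M(x)\le x$ for all $x>0$ (i.e. dominated by the identity function $\mathrm{id}$); $\mathcal{K}:\mathcal{I}\to\mathcal{I}$, $\mathcal{K}(M)(x)=\int_{[x,\infty)}M(y)K(x,\mathrm{d}y)$; $\mathcal{K}^0(M)=M$, $\mathcal{K}^n(M)=\mathcal{K}(\mathcal{K}^{n-1}(M))$; $\mathcal{K}^\infty(\mathrm{id})=\lim_{n\to\infty}\mathcal{K}^n(\mathrm{id})$ pointwise (the sequence is nonincreasing, so the limit exists). "Maximal" refers to the pointwise order. *)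

theory Defs
  imports "HOL-Probability.Probability"
begin

abbreviation pos_borel :: "real measure" where
  "pos_borel \<equiv> restrict_space borel {0<..}"

(* Kernels, and the functions M below, are functions on all of real, but only their values
   at positive arguments are ever constrained or used. *)
definition martingale_kernel :: "(real \<Rightarrow> real measure) \<Rightarrow> bool" where
  "martingale_kernel K \<longleftrightarrow>
     K \<in> pos_borel \<rightarrow>\<^sub>M prob_algebra pos_borel \<and>
     (\<forall>x>0. has_bochner_integral (K x) (\<lambda>y. y) x)"

definition natural_filtration ::
    "'w measure \<Rightarrow> (nat \<Rightarrow> 'w \<Rightarrow> real) \<Rightarrow> nat \<Rightarrow> 'w measure" where
  "natural_filtration P S n =
     sigma (space P) {S k -` B \<inter> space P | k B. k \<le> n \<and> B \<in> sets pos_borel}"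

definition markov_chain ::
    "(real \<Rightarrow> real measure) \<Rightarrow> real \<Rightarrow> 'w measure \<Rightarrow> (nat \<Rightarrow> 'w \<Rightarrow> real) \<Rightarrow> bool" where
  "markov_chain K x P S \<longleftrightarrow>
     prob_space P \<and>
     (\<forall>n. S n \<in> P \<rightarrow>\<^sub>M pos_borel) \<and>
     (AE \<omega> in P. S 0 \<omega> = x) \<and>
     (\<forall>n. \<forall>B\<in>sets pos_borel. AE \<omega> in P.
        real_cond_exp P (natural_filtration P S n)
          (indicator {\<omega>\<in>space P. S (Suc n) \<omega> \<in> B}) \<omega> = measure (K (S n \<omega>)) B)"

(* For a positive Markov martingale the paths converge almost surely; on the null set where
   they do not, the value of lim is a constant that does not affect any expectation below. *)
definition S_limit :: "(nat \<Rightarrow> 'w \<Rightarrow> real) \<Rightarrow> 'w \<Rightarrow> real" where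
  "S_limit S \<omega> = lim (\<lambda>n. S n \<omega>)"

(* The event S_n >= S_(n-1) >= ... >= S_1 >= x, for n >= 1. The value at n = 0 is irrelevant:
   only the limit in n is used. *)
definition increasing_event ::
    "(nat \<Rightarrow> 'w \<Rightarrow> real) \<Rightarrow> real \<Rightarrow> nat \<Rightarrow> 'w set" where
  "increasing_event S x n = {\<omega>. x \<le> S 1 \<omega> \<and> (\<forall>k\<in>{1..<n}. S k \<omega> \<le> S (Suc k) \<omega>)}"

definition default_function ::
    "(real \<Rightarrow> 'w measure) \<Rightarrow> (nat \<Rightarrow> 'w \<Rightarrow> real) \<Rightarrow> real \<Rightarrow> real" where
  "default_function P S x =
     lim (\<lambda>n. \<integral>\<omega>. (S n \<omega> - S_limit S \<omega>) * indicator (increasing_event S x n) \<omega> \<partial>P x)"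

definition id_dominated :: "(real \<Rightarrow> real) set" where
  "id_dominated = {M. M \<in> borel_measurable pos_borel \<and> (\<forall>x>0. 0 \<le> M x \<and> M x \<le> x)}"

definition kernel_op :: "(real \<Rightarrow> real measure) \<Rightarrow> (real \<Rightarrow> real) \<Rightarrow> real \<Rightarrow> real" where
  "kernel_op K M x = (LINT y:{x..}|K x. M y)"

definition kernel_op_infinity ::
    "(real \<Rightarrow> real measure) \<Rightarrow> (real \<Rightarrow> real) \<Rightarrow> real \<Rightarrow> real" where
  "kernel_op_infinity K M x = lim (\<lambda>n. (kernel_op K ^^ n) M x)"

end

theory Submission
  imports Defs
begin

text \<open>By the Markov property, \<open>E\<^sub>x[f(S\<^sub>n); S\<^sub>n \<ge> \<dots> \<ge> S\<^sub>1 \<ge> x]\<close> is the \<open>n\<close>-th iterate of the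
  kernel operator applied to \<open>f\<close>. With \<open>f = 1\<close>, the assumption on downward steps forces these
  increasing events to have probability tending to zero, so the contribution of the integrable
  limit \<open>S\<^sub>\<infinity>\<close> vanishes and the default function is \<open>\<K>\<^sup>\<infinity>(id)\<close>. The fixed point equation is dominated
  convergence, and maximality is monotonicity of the operator. If \<open>M\<^sub>S \<le> q id\<close> holds near infinity
  for some \<open>q < 1\<close>, then \<open>M\<^sub>S \<le> q id + y\<close> everywhere for a constant \<open>y\<close>; iterating the operator gives
  \<open>M\<^sub>S \<le> q M\<^sub>S\<close>, that is, \<open>M\<^sub>S = 0\<close>.\<close>

subsection \<open>The kernel operator\<close>

text \<open>Composition with the inclusion of the positive half-line into the reals; with these
  rules \<open>measurable\<close> can treat comparisons of the two coordinates.\<close>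

lemma
  shows measurable_fst_pos_borel [measurable]: "fst \<in> borel_measurable (pos_borel \<Otimes>\<^sub>M pos_borel)"
    and measurable_snd_pos_borel [measurable]: "snd \<in> borel_measurable (pos_borel \<Otimes>\<^sub>M pos_borel)"
  by (rule measurable_compose[OF measurable_fst] measurable_compose[OF measurable_snd],
      auto intro!: measurable_restrict_space1)+

locale positive_martingale_kernel =
  fixes K :: "real \<Rightarrow> real measure"
  assumes martingale_kernel: "martingale_kernel K"
begin

lemma measurable_kernel_prob [measurable]: "K \<in> pos_borel \<rightarrow>\<^sub>M prob_algebra pos_borel"
  using martingale_kernel by (simp add: martingale_kernel_def)

lemma measurable_kernel_subprob [measurable]: "K \<in> pos_borel \<rightarrow>\<^sub>M subprob_algebra pos_borel"
  by (rule measurable_prob_algebraD) measurable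

lemma
  assumes "x > 0"
  shows sets_kernel: "sets (K x) = sets pos_borel"
    and prob_space_kernel: "prob_space (K x)"
proof -
  have "K x \<in> space (prob_algebra pos_borel)"
    using measurable_kernel_prob by (rule measurable_space) (simp add: assms space_restrict_space)
  then show "sets (K x) = sets pos_borel" "prob_space (K x)"
    by (auto simp: space_prob_algebra)
qed

lemma space_kernel: "x > 0 \<Longrightarrow> space (K x) = {0<..}"
  using sets_eq_imp_space_eq[OF sets_kernel] by (simp add: space_restrict_space)

lemma measurable_on_kernel: "x > 0 \<Longrightarrow> f \<in> pos_borel \<rightarrow>\<^sub>M N \<Longrightarrow> f \<in> K x \<rightarrow>\<^sub>M N"
  using measurable_cong_sets[OF sets_kernel refl] by blast

lemma
  assumes "x > 0"
  shows integrable_kernel_id: "integrable (K x) (\<lambda>y. y)"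
    and integral_kernel_id: "(LINT y|K x. y) = x"
  using martingale_kernel assms by (auto simp: martingale_kernel_def has_bochner_integral_iff)

lemma nn_integral_kernel_id: "x > 0 \<Longrightarrow> (\<integral>\<^sup>+y. ennreal y \<partial>K x) = ennreal x"
  by (subst nn_integral_eq_integral)
    (auto simp: integrable_kernel_id integral_kernel_id space_kernel intro!: AE_I2)

text \<open>The extended nonnegative version of \<open>kernel_op\<close> requires no integrability,
  and it also acts on the constant function 1, which the identity does not dominate.\<close>

definition nn_kernel_op :: "(real \<Rightarrow> ennreal) \<Rightarrow> real \<Rightarrow> ennreal" where
  "nn_kernel_op f x = (\<integral>\<^sup>+y. indicator {x..} y * f y \<partial>K x)"

text \<open>The cut-off \<open>{x..}\<close> moves with the argument, so joint measurability in both
  variables is needed; written as a conditional, it reduces to that of the relation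
  \<open>x \<le> y\<close>.\<close>

lemma measurable_nn_kernel_op [measurable]:
  assumes [measurable]: "f \<in> borel_measurable pos_borel"
  shows "nn_kernel_op f \<in> borel_measurable pos_borel"
proof -
  have "(\<lambda>x. \<integral>\<^sup>+y. (if x \<le> y then f y else 0) \<partial>K x) \<in> borel_measurable pos_borel"
    by (rule nn_integral_measurable_subprob_algebra2[OF _ measurable_kernel_subprob])
      (unfold split_beta', measurable)
  moreover have "nn_kernel_op f = (\<lambda>x. \<integral>\<^sup>+y. (if x \<le> y then f y else 0) \<partial>K x)"
    unfolding nn_kernel_op_def by (intro ext nn_integral_cong) (auto split: split_indicator)
  ultimately show ?thesis
    by simp
qed

lemma measurable_nn_kernel_op_power [measurable]:
  "f \<in> borel_measurable pos_borel \<Longrightarrow> (nn_kernel_op ^^ n) f \<in> borel_measurable pos_borel"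
  by (induction n) (auto simp: measurable_nn_kernel_op)

lemma nn_kernel_op_mono:
  assumes "x > 0" "\<And>y. y \<ge> x \<Longrightarrow> f y \<le> g y"
  shows "nn_kernel_op f x \<le> nn_kernel_op g x"
  unfolding nn_kernel_op_def using assms
  by (intro nn_integral_mono) (auto split: split_indicator)

text \<open>Every application looks only to the right of its argument, so a comparison on
  \<open>{x..}\<close> survives all iterations.\<close>

lemma nn_kernel_op_power_mono:
  assumes "x > 0" "\<And>y. y \<ge> x \<Longrightarrow> f y \<le> g y"
  shows "(nn_kernel_op ^^ n) f x \<le> (nn_kernel_op ^^ n) g x"
  using assms
proof (induction n arbitrary: x)
  case (Suc n)
  then show ?case
    by (auto intro!: nn_kernel_op_mono Suc.IH)
qed auto

text \<open>Lets the two-term majorants below be iterated term by term: a multiple of the identity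
  plus an indicator or a constant.\<close>

lemma nn_kernel_op_power_linear:
  assumes "x > 0" and [measurable]: "f \<in> borel_measurable pos_borel" "g \<in> borel_measurable pos_borel"
  shows "(nn_kernel_op ^^ n) (\<lambda>y. c * f y + d * g y) x =
    c * (nn_kernel_op ^^ n) f x + d * (nn_kernel_op ^^ n) g x"
  using \<open>x > 0\<close>
proof (induction n arbitrary: x)
  case (Suc n)
  let ?F = "(nn_kernel_op ^^ n) f" and ?G = "(nn_kernel_op ^^ n) g"
  have [measurable]: "?F \<in> borel_measurable (K x)" "?G \<in> borel_measurable (K x)"
    "indicator {x..} \<in> borel_measurable (K x)"
    using Suc.prems by (auto intro!: measurable_on_kernel measurable_restrict_space1)
  have "(nn_kernel_op ^^ Suc n) (\<lambda>y. c * f y + d * g y) x =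
      (\<integral>\<^sup>+y. c * (indicator {x..} y * ?F y) + d * (indicator {x..} y * ?G y) \<partial>K x)"
    using Suc.prems
    by (auto simp: nn_kernel_op_def[of "(nn_kernel_op ^^ n) (\<lambda>y. c * f y + d * g y)"] space_kernel
        Suc.IH split: split_indicator intro!: nn_integral_cong)
  also have "\<dots> = c * nn_kernel_op ?F x + d * nn_kernel_op ?G x"
    by (simp add: nn_integral_add nn_integral_cmult nn_kernel_op_def)
  finally show ?case
    by simp
qed auto

text \<open>The mean of \<open>K x\<close> is \<open>x\<close>, and cutting off the part below
  \<open>x\<close> can only lower it.\<close>

lemma nn_kernel_op_id_le: "x > 0 \<Longrightarrow> nn_kernel_op ennreal x \<le> ennreal x"
  unfolding nn_kernel_op_def
  by (subst (2) nn_integral_kernel_id[symmetric])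
    (auto intro!: nn_integral_mono split: split_indicator)

lemma nn_kernel_op_power_id_le: "x > 0 \<Longrightarrow> (nn_kernel_op ^^ n) ennreal x \<le> ennreal x"
proof (induction n arbitrary: x)
  case (Suc n)
  then have "(nn_kernel_op ^^ Suc n) ennreal x \<le> nn_kernel_op ennreal x"
    by (auto intro!: nn_kernel_op_mono)
  with nn_kernel_op_id_le[OF Suc.prems] show ?case
    by order
qed auto

section \<open>The operator on functions dominated by the identity\<close>

lemma integrable_id_dominated:
  assumes "M \<in> id_dominated" "x > 0"
  shows "integrable (K x) (\<lambda>y. indicator {x..} y * M y)"
proof (rule Bochner_Integration.integrable_bound[OF integrable_kernel_id[OF \<open>x > 0\<close>]])
  have [measurable]: "M \<in> borel_measurable (K x)" "indicator {x..} \<in> borel_measurable (K x)"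
    using assms by (auto simp: id_dominated_def intro!: measurable_on_kernel measurable_restrict_space1)
  show "(\<lambda>y. indicator {x..} y * M y) \<in> borel_measurable (K x)"
    by measurable
  show "AE y in K x. norm (indicator {x..} y * M y) \<le> norm y"
    using assms by (auto simp: space_kernel id_dominated_def split: split_indicator intro!: AE_I2)
qed

text \<open>Bridge from the Bochner integral of the definition to the nonnegative integral in which
  iterates are estimated; domination supplies integrability and the sign.\<close>

lemma ennreal_kernel_op:
  assumes "M \<in> id_dominated" "x > 0"
  shows "ennreal (kernel_op K M x) = nn_kernel_op (\<lambda>y. ennreal (M y)) x"
proof -
  have "AE y in K x. 0 \<le> indicator {x..} y * M y"
    using assms by (auto simp: space_kernel id_dominated_def split: split_indicator intro!: AE_I2)
  from nn_integral_eq_integral[OF integrable_id_dominated[OF assms] this, symmetric] show ?thesis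
    by (auto simp: kernel_op_def set_lebesgue_integral_def nn_kernel_op_def
        intro!: nn_integral_cong split: split_indicator)
qed

lemma kernel_op_mono:
  assumes "M \<in> id_dominated" "N \<in> id_dominated" "x > 0" "\<And>y. y > 0 \<Longrightarrow> M y \<le> N y"
  shows "kernel_op K M x \<le> kernel_op K N x"
  unfolding kernel_op_def set_lebesgue_integral_def using assms
  by (auto intro!: integral_mono integrable_id_dominated simp: space_kernel split: split_indicator)

lemma id_in_id_dominated: "(\<lambda>x. x) \<in> id_dominated"
  by (auto simp: id_dominated_def intro!: measurable_restrict_space1)

text \<open>The upper bound is the martingale property in the form
  \<open>nn_kernel_op_id_le\<close>; measurability is inherited from \<open>nn_kernel_op\<close>
  through \<open>enn2real\<close>.\<close>

lemma kernel_op_id_dominated: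
  assumes M: "M \<in> id_dominated"
  shows "kernel_op K M \<in> id_dominated"
proof -
  have "0 \<le> kernel_op K M x \<and> kernel_op K M x \<le> x" if "x > 0" for x
  proof
    show "0 \<le> kernel_op K M x"
      unfolding kernel_op_def set_lebesgue_integral_def using that M
      by (intro Bochner_Integration.integral_nonneg)
        (auto simp: space_kernel id_dominated_def split: split_indicator)
    have "kernel_op K M x \<le> kernel_op K (\<lambda>x. x) x"
      using M that by (intro kernel_op_mono id_in_id_dominated) (auto simp: id_dominated_def)
    also have "ennreal \<dots> \<le> ennreal x"
      using that by (simp add: ennreal_kernel_op id_in_id_dominated nn_kernel_op_id_le)
    then have "kernel_op K (\<lambda>x. x) x \<le> x"
      using that by (simp add: ennreal_le_iff)
    finally show "kernel_op K M x \<le> x" .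
  qed
  moreover have "kernel_op K M \<in> borel_measurable pos_borel"
  proof -
    have [measurable]: "M \<in> borel_measurable pos_borel"
      using M by (simp add: id_dominated_def)
    have "kernel_op K M x = enn2real (nn_kernel_op (\<lambda>y. ennreal (M y)) x)" if "x \<in> space pos_borel" for x
      using that M \<open>\<And>x. x > 0 \<Longrightarrow> 0 \<le> kernel_op K M x \<and> kernel_op K M x \<le> x\<close>
      by (simp add: ennreal_kernel_op[symmetric] space_restrict_space)
    then show ?thesis
      by (subst measurable_cong) measurable
  qed
  ultimately show ?thesis
    by (auto simp: id_dominated_def)
qed

lemma kernel_op_power_id_dominated: "M \<in> id_dominated \<Longrightarrow> (kernel_op K ^^ n) M \<in> id_dominated"
  by (induction n) (auto intro: kernel_op_id_dominated)

lemma ennreal_kernel_op_power: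
  assumes "M \<in> id_dominated" "x > 0"
  shows "ennreal ((kernel_op K ^^ n) M x) = (nn_kernel_op ^^ n) (\<lambda>y. ennreal (M y)) x"
  using \<open>x > 0\<close>
proof (induction n arbitrary: x)
  case (Suc n)
  then have "ennreal ((kernel_op K ^^ Suc n) M x) =
      nn_kernel_op (\<lambda>y. ennreal ((kernel_op K ^^ n) M y)) x"
    by (simp add: ennreal_kernel_op kernel_op_power_id_dominated assms)
  \<comment> \<open>The induction hypothesis identifies the two functions only at positive
    arguments, so monotonicity in both directions replaces rewriting under the operator.\<close>
  also have "\<dots> = nn_kernel_op ((nn_kernel_op ^^ n) (\<lambda>y. ennreal (M y))) x"
    using Suc by (auto intro!: antisym nn_kernel_op_mono)
  finally show ?case
    by simp
qed auto

lemma kernel_op_power_mono: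
  assumes "M \<in> id_dominated" "N \<in> id_dominated" "x > 0" "\<And>y. y > 0 \<Longrightarrow> M y \<le> N y"
  shows "(kernel_op K ^^ n) M x \<le> (kernel_op K ^^ n) N x"
  using \<open>x > 0\<close>
proof (induction n arbitrary: x)
  case (Suc n)
  then show ?case
    by (auto intro!: kernel_op_mono kernel_op_power_id_dominated assms)
qed (use assms in auto)

text \<open>With the extra application moved innermost, the claim is that one application lowers the
  identity, carried along by the monotone iterate.\<close>

lemma decseq_kernel_op_power_id:
  assumes "x > 0"
  shows "decseq (\<lambda>n. (kernel_op K ^^ n) (\<lambda>x. x) x)"
proof (rule decseq_SucI)
  fix n
  have "(kernel_op K ^^ Suc n) (\<lambda>x. x) x = (kernel_op K ^^ n) (kernel_op K (\<lambda>x. x)) x"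
    by (simp add: funpow_swap1)
  also have "\<dots> \<le> (kernel_op K ^^ n) (\<lambda>x. x) x"
    using kernel_op_id_dominated[OF id_in_id_dominated] assms
    by (intro kernel_op_power_mono id_in_id_dominated) (auto simp: id_dominated_def)
  finally show "(kernel_op K ^^ Suc n) (\<lambda>x. x) x \<le> (kernel_op K ^^ n) (\<lambda>x. x) x" .
qed

section \<open>The limit of the iterates as the largest fixed point\<close>

abbreviation kernel_op_limit :: "real \<Rightarrow> real" where
  "kernel_op_limit \<equiv> kernel_op_infinity K (\<lambda>x. x)"

lemma kernel_op_power_id_tendsto:
  assumes "x > 0"
  shows "(\<lambda>n. (kernel_op K ^^ n) (\<lambda>x. x) x) \<longlonglongrightarrow> kernel_op_limit x"
proof -
  have "\<And>n. 0 \<le> (kernel_op K ^^ n) (\<lambda>x. x) x"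
    using kernel_op_power_id_dominated[OF id_in_id_dominated] assms by (auto simp: id_dominated_def)
  then have "convergent (\<lambda>n. (kernel_op K ^^ n) (\<lambda>x. x) x)"
    using decseq_convergent[OF decseq_kernel_op_power_id[OF assms]] convergentI by metis
  then show ?thesis
    unfolding kernel_op_infinity_def by (simp add: convergent_LIMSEQ_iff)
qed

lemma kernel_op_limit_le_power: "x > 0 \<Longrightarrow> kernel_op_limit x \<le> (kernel_op K ^^ n) (\<lambda>x. x) x"
  using decseq_ge[OF decseq_kernel_op_power_id kernel_op_power_id_tendsto] .

lemma kernel_op_limit_id_dominated: "kernel_op_limit \<in> id_dominated"
proof -
  have [measurable]: "(kernel_op K ^^ n) (\<lambda>x. x) \<in> borel_measurable pos_borel" for n
    using kernel_op_power_id_dominated[OF id_in_id_dominated] by (auto simp: id_dominated_def)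
  have "kernel_op_limit \<in> borel_measurable pos_borel"
    unfolding kernel_op_infinity_def[abs_def] by measurable
  moreover have "0 \<le> kernel_op_limit x" if "x > 0" for x
    using kernel_op_power_id_dominated[OF id_in_id_dominated] that
    by (intro LIMSEQ_le_const[OF kernel_op_power_id_tendsto]) (auto simp: id_dominated_def)
  ultimately show ?thesis
    \<comment> \<open>The iterate of index 0 is the identity, which gives the upper bound.\<close>
    using kernel_op_limit_le_power[of _ 0] by (auto simp: id_dominated_def)
qed

text \<open>The iterates of index \<open>Suc n\<close> converge to both sides: to the left one by
  dominated convergence with the identity as majorant, to the right one as a shifted
  sequence.\<close>

lemma kernel_op_limit_fixed_point:
  assumes x: "x > 0"
  shows "kernel_op K kernel_op_limit x = kernel_op_limit x"
proof (rule LIMSEQ_unique)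
  let ?I = "\<lambda>n. (kernel_op K ^^ n) (\<lambda>x. x)"
  have I: "?I n \<in> id_dominated" for n
    by (rule kernel_op_power_id_dominated[OF id_in_id_dominated])
  have "(\<lambda>n. LINT y|K x. indicator {x..} y * ?I n y) \<longlonglongrightarrow>
      (LINT y|K x. indicator {x..} y * kernel_op_limit y)"
  proof (rule integral_dominated_convergence)
    show "integrable (K x) (\<lambda>y. y)"
      by (rule integrable_kernel_id[OF x])
    show "AE y in K x. (\<lambda>n. indicator {x..} y * ?I n y) \<longlonglongrightarrow> indicator {x..} y * kernel_op_limit y"
      by (auto intro!: AE_I2 tendsto_intros kernel_op_power_id_tendsto simp: space_kernel x)
    show "AE y in K x. norm (indicator {x..} y * ?I n y) \<le> y" for n
      using I by (auto simp: space_kernel x id_dominated_def split: split_indicator intro!: AE_I2)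
  qed (use I x in \<open>auto intro!: borel_measurable_integrable integrable_id_dominated
    kernel_op_limit_id_dominated\<close>)
  then show "(\<lambda>n. ?I (Suc n) x) \<longlonglongrightarrow> kernel_op K kernel_op_limit x"
    by (simp add: kernel_op_def set_lebesgue_integral_def)
  show "(\<lambda>n. ?I (Suc n) x) \<longlonglongrightarrow> kernel_op_limit x"
    using kernel_op_power_id_tendsto[OF x] by (rule LIMSEQ_Suc)
qed

text \<open>The fixed point equation holds only at positive arguments, so it is iterated pointwise,
  using monotonicity in both directions.\<close>

lemma kernel_op_power_fixed_point:
  assumes "\<And>x. x > 0 \<Longrightarrow> M x = kernel_op K M x" "M \<in> id_dominated" "x > 0"
  shows "(kernel_op K ^^ n) M x = M x"
  using \<open>x > 0\<close>
proof (induction n arbitrary: x)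
  case (Suc n)
  then have "(kernel_op K ^^ Suc n) M x = kernel_op K M x"
    by (auto intro!: antisym kernel_op_mono kernel_op_power_id_dominated assms)
  with assms(1)[OF Suc.prems] show ?case
    by simp
qed auto

text \<open>A fixed point equals its own iterates, and these lie below the iterates of the
  identity.\<close>

lemma fixed_point_le_kernel_op_limit:
  assumes "\<And>x. x > 0 \<Longrightarrow> M x = kernel_op K M x" "M \<in> id_dominated" "x > 0"
  shows "M x \<le> kernel_op_limit x"
proof (rule LIMSEQ_le_const[OF kernel_op_power_id_tendsto[OF \<open>x > 0\<close>]])
  have "M x \<le> (kernel_op K ^^ n) (\<lambda>x. x) x" for n
    using kernel_op_power_mono[OF assms(2) id_in_id_dominated assms(3), of n] assms(2)
    by (simp add: kernel_op_power_fixed_point[OF assms] id_dominated_def)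
  then show "\<exists>N. \<forall>n\<ge>N. M x \<le> (kernel_op K ^^ n) (\<lambda>x. x) x"
    by blast
qed

text \<open>A nondecreasing path from \<open>z \<ge> x\<close> that ends below \<open>y\<close>
  stays in \<open>{x..y}\<close> throughout, and from there each step avoids going down with
  probability at most \<open>1 - \<epsilon>\<close>.\<close>

lemma nn_kernel_op_power_indicator_le:
  assumes "x > 0" "\<epsilon> \<le> 1" and \<epsilon>: "\<And>z. z \<in> {x..y} \<Longrightarrow> \<epsilon> \<le> measure (K z) {0<..<z}"
    and "z \<ge> x"
  shows "(nn_kernel_op ^^ n) (indicator {..y}) z \<le> ennreal ((1 - \<epsilon>) ^ n) * indicator {..y} z"
  using \<open>z \<ge> x\<close>
proof (induction n arbitrary: z)
  case (Suc n)
  let ?c = "ennreal ((1 - \<epsilon>) ^ n)"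
  have z: "z > 0"
    using Suc.prems \<open>x > 0\<close> by simp
  interpret Kz: prob_space "K z"
    by (rule prob_space_kernel[OF z])
  have [measurable]: "{0<..<z} \<in> sets (K z)" "{z..} \<in> sets (K z)"
    using z by (auto simp: sets_kernel sets_restrict_space_iff)
  have "(nn_kernel_op ^^ Suc n) (indicator {..y}) z \<le> nn_kernel_op (\<lambda>w. ?c * indicator {..y} w) z"
    using Suc z by (auto intro!: nn_kernel_op_mono)
  also have "\<dots> \<le> ennreal ((1 - \<epsilon>) ^ Suc n) * indicator {..y} z"
  proof (cases "z \<le> y")
    case True
    \<comment> \<open>The upper barrier is dropped here; the factor \<open>1 - \<epsilon>\<close>
      comes only from not stepping down.\<close>
    have "nn_kernel_op (\<lambda>w. ?c * indicator {..y} w) z \<le> (\<integral>\<^sup>+w. ?c * indicator {z..} w \<partial>K z)"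
      unfolding nn_kernel_op_def by (intro nn_integral_mono) (auto split: split_indicator)
    also have "\<dots> = ?c * ennreal (Kz.prob {z..})"
      by (simp add: nn_integral_cmult_indicator Kz.emeasure_eq_measure)
    also have "{z..} = space (K z) - {0<..<z}"
      using z by (auto simp: space_kernel)
    also have "Kz.prob \<dots> = 1 - Kz.prob {0<..<z}"
      by (rule Kz.prob_compl) measurable
    also have "?c * ennreal \<dots> \<le> ?c * ennreal (1 - \<epsilon>)"
      using \<epsilon>[of z] True Suc.prems by (intro mult_left_mono ennreal_leI) auto
    also have "\<dots> = ennreal ((1 - \<epsilon>) ^ Suc n) * indicator {..y} z"
      using True \<open>\<epsilon> \<le> 1\<close> by (simp add: ennreal_mult' mult.commute)
    finally show ?thesis .
  next
    case False
    \<comment> \<open>From above \<open>y\<close>, upward steps never return below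
      \<open>y\<close>.\<close>
    then have "nn_kernel_op (\<lambda>w. ?c * indicator {..y} w) z = (\<integral>\<^sup>+w. 0 \<partial>K z)"
      unfolding nn_kernel_op_def by (intro nn_integral_cong) (auto split: split_indicator)
    then show ?thesis
      by simp
  qed
  finally show ?case .
qed auto

text \<open>Guarantees finiteness, so that \<open>enn2real\<close> loses nothing when these values
  are moved to the reals.\<close>

lemma nn_kernel_op_power_one_le: "x > 0 \<Longrightarrow> (nn_kernel_op ^^ n) (\<lambda>_. 1) x \<le> 1"
proof (induction n arbitrary: x)
  case (Suc n)
  then interpret prob_space "K x"
    by (intro prob_space_kernel)
  have "(nn_kernel_op ^^ Suc n) (\<lambda>_. 1) x \<le> nn_kernel_op (\<lambda>_. 1) x"
    using Suc by (auto intro!: nn_kernel_op_mono)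
  also have "\<dots> \<le> (\<integral>\<^sup>+y. 1 \<partial>K x)"
    unfolding nn_kernel_op_def by (intro nn_integral_mono) (auto split: split_indicator)
  finally show ?case
    by (simp add: emeasure_space_1)
qed auto

end

subsection \<open>Kernels with downward steps\<close>

text \<open>The condition on the infimum of \<open>a\<close>, stated for the kernel alone and as a
  uniform lower bound.\<close>

locale downward_martingale_kernel = positive_martingale_kernel +
  assumes downward: "\<And>u v. 0 < u \<Longrightarrow> u < v \<Longrightarrow> \<exists>\<epsilon>>0. \<forall>z\<in>{u..v}. \<epsilon> \<le> measure (K z) {0<..<z}"
begin

text \<open>Paths of increasing steps that stay below \<open>y\<close> die out geometrically, and the martingale
  property makes climbing above \<open>y\<close> cost a factor \<open>x / y\<close>.\<close>

lemma nn_kernel_op_power_one_tendsto: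
  assumes x: "x > 0"
  shows "(\<lambda>n. enn2real ((nn_kernel_op ^^ n) (\<lambda>_. 1) x)) \<longlonglongrightarrow> 0"
proof (rule LIMSEQ_I)
  let ?v = "\<lambda>n. (nn_kernel_op ^^ n) (\<lambda>_. 1) x"
  fix r :: real assume "r > 0"
  \<comment> \<open>Chosen so that \<open>x / y = r / (r + 2)\<close>, which is below
    \<open>r / 2\<close>.\<close>
  define y where "y = x * (1 + 2 / r)"
  have "x < y"
    using \<open>r > 0\<close> x by (simp add: y_def field_simps)
  then have "y > 0"
    using x by simp
  have "x / y < r / 2"
    using \<open>r > 0\<close> x \<open>y > 0\<close> by (simp add: y_def field_simps)
  from downward[OF x \<open>x < y\<close>] obtain \<epsilon>
    where "\<epsilon> > 0" and \<epsilon>: "\<And>z. z \<in> {x..y} \<Longrightarrow> \<epsilon> \<le> measure (K z) {0<..<z}"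
    by auto
  have "\<epsilon> \<le> 1"
    using \<epsilon>[of x] \<open>x < y\<close> prob_space.prob_le_1[OF prob_space_kernel[OF x]] order_trans by force
  have v: "enn2real (?v n) \<le> (1 - \<epsilon>) ^ n + x / y" for n
  proof -
    \<comment> \<open>As in Markov's inequality, 1 is bounded by the indicator of
      \<open>{..y}\<close> plus \<open>z / y\<close>. The first term decays geometrically, the
      second contributes at most \<open>x / y\<close>.\<close>
    have "?v n \<le> (nn_kernel_op ^^ n) (\<lambda>z. 1 * indicator {..y} z + ennreal (1 / y) * ennreal z) x"
    proof (rule nn_kernel_op_power_mono[OF x])
      fix z assume "z \<ge> x"
      have "1 \<le> ennreal (1 / y) * ennreal z" if "z > y"
        using that \<open>y > 0\<close> by (simp add: ennreal_mult'[symmetric] del: divide_eq_eq)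
      then show "1 \<le> 1 * indicator {..y} z + ennreal (1 / y) * ennreal z"
        by (cases "z \<le> y") (auto split: split_indicator)
    qed
    also have "\<dots> = 1 * (nn_kernel_op ^^ n) (indicator {..y}) x
        + ennreal (1 / y) * (nn_kernel_op ^^ n) ennreal x"
      by (rule nn_kernel_op_power_linear[OF x]) (auto intro!: measurable_restrict_space1)
    also have "\<dots> \<le> 1 * (ennreal ((1 - \<epsilon>) ^ n) * indicator {..y} x) + ennreal (1 / y) * ennreal x"
      using nn_kernel_op_power_indicator_le[OF x \<open>\<epsilon> \<le> 1\<close> \<epsilon> order.refl] nn_kernel_op_power_id_le[OF x]
      by (intro add_mono mult_left_mono) auto
    also have "\<dots> = ennreal ((1 - \<epsilon>) ^ n + x / y)"
      using x \<open>x < y\<close> \<open>\<epsilon> \<le> 1\<close> \<open>y > 0\<close> by (simp add: ennreal_mult'[symmetric])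
    finally show ?thesis
      using x \<open>\<epsilon> \<le> 1\<close> \<open>y > 0\<close> by (intro enn2real_leI) auto
  qed
  have "(\<lambda>n. (1 - \<epsilon>) ^ n) \<longlonglongrightarrow> 0"
    using \<open>\<epsilon> > 0\<close> \<open>\<epsilon> \<le> 1\<close> by (intro LIMSEQ_realpow_zero) auto
  then have "eventually (\<lambda>n. (1 - \<epsilon>) ^ n < r / 2) sequentially"
    by (rule order_tendstoD(2)) (use \<open>r > 0\<close> in simp)
  then have "eventually (\<lambda>n. norm (enn2real (?v n) - 0) < r) sequentially"
  proof eventually_elim
    case (elim n)
    then show ?case
      using v[of n] \<open>x / y < r / 2\<close> unfolding diff_0_right real_norm_def abs_of_nonneg[OF enn2real_nonneg]
      by linarith
  qed
  then show "\<exists>N. \<forall>n\<ge>N. norm (enn2real (?v n) - 0) < r"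
    by (simp add: eventually_sequentially)
qed

text \<open>A single application already falls strictly below the identity: \<open>K x\<close>
  charges \<open>{0<..<x}\<close>, so this interval carries a positive part of the mean
  \<open>x\<close>.\<close>

lemma kernel_op_limit_less:
  assumes x: "x > 0"
  shows "kernel_op_limit x < x"
proof -
  interpret prob_space "K x"
    by (rule prob_space_kernel[OF x])
  have A [measurable]: "{0<..<x} \<in> sets (K x)" "{x..} \<in> sets (K x)"
    using x by (auto simp: sets_kernel sets_restrict_space_iff)
  have [measurable]: "(\<lambda>y. y) \<in> borel_measurable (K x)"
    using x by (intro measurable_on_kernel) (auto intro!: measurable_restrict_space1)
  \<comment> \<open>Any interval starting at \<open>x\<close> would do; only its left end point is
    used.\<close>
  obtain \<epsilon> where "\<epsilon> > 0" "\<epsilon> \<le> prob {0<..<x}"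
    using downward[of x "2 * x"] x by auto
  then have pos: "prob {0<..<x} > 0"
    by simp
  have int: "integrable (K x) (\<lambda>y. indicator {0<..<x} y * y)"
    using integrable_real_mult_indicator[OF A(1) integrable_kernel_id[OF x]] by (simp add: mult.commute)
  have "x = (LINT y|K x. indicator {x..} y * y + indicator {0<..<x} y * y)"
    by (subst (1) integral_kernel_id[OF x, symmetric], intro Bochner_Integration.integral_cong)
      (auto simp: space_kernel x split: split_indicator)
  also have "\<dots> = kernel_op K (\<lambda>x. x) x + (LINT y|K x. indicator {0<..<x} y * y)"
    using integrable_id_dominated[OF id_in_id_dominated x] int
    by (simp add: kernel_op_def set_lebesgue_integral_def)
  finally have *: "x = kernel_op K (\<lambda>x. x) x + (LINT y|K x. indicator {0<..<x} y * y)" .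
  have nonneg: "AE y in K x. 0 \<le> indicator {0<..<x} y * y"
    by (auto split: split_indicator)
  have "(LINT y|K x. indicator {0<..<x} y * y) \<noteq> 0"
  proof
    assume "(LINT y|K x. indicator {0<..<x} y * y) = 0"
    then have "AE y in K x. indicator {0<..<x} y * y = 0"
      using integral_nonneg_eq_0_iff_AE[OF int nonneg] by simp
    then have "AE y in K x. y \<notin> {0<..<x}"
      by eventually_elim (auto split: split_indicator_asm)
    then have "prob {0<..<x} = 0"
      by (subst prob_eq_0) auto
    with pos show False
      by simp
  qed
  moreover have "(LINT y|K x. indicator {0<..<x} y * y) \<ge> 0"
    using nonneg by (rule integral_nonneg_AE)
  ultimately have "kernel_op K (\<lambda>x. x) x < x"
    using * by linarith
  with kernel_op_limit_le_power[OF x, of 1] show ?thesis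
    by simp
qed

text \<open>The core of the limsup claim: iterating the operator on the majorant
  \<open>q * z + y\<close> annihilates the constant and turns the identity into the limit
  function.\<close>

lemma kernel_op_limit_eq_0:
  assumes q: "0 \<le> q" "q < 1" and "y > 0" and le: "\<And>z. z \<ge> y \<Longrightarrow> kernel_op_limit z \<le> q * z"
    and x: "x > 0"
  shows "kernel_op_limit x = 0"
proof -
  let ?M = kernel_op_limit
  let ?I = "\<lambda>n. (kernel_op K ^^ n) (\<lambda>x. x) x"
  let ?v = "\<lambda>n. (nn_kernel_op ^^ n) (\<lambda>_. 1) x"
  have M: "0 \<le> ?M z" "?M z \<le> z" if "z > 0" for z
    using kernel_op_limit_id_dominated that by (auto simp: id_dominated_def)
  have "?M x \<le> q * ?I n + y * enn2real (?v n)" for n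
  proof -
    have I: "0 \<le> ?I n"
      using kernel_op_power_id_dominated[OF id_in_id_dominated] x by (auto simp: id_dominated_def)
    \<comment> \<open>As a fixed point, the limit function is its own iterate, so the iterates of
      any majorant bound it.\<close>
    have "ennreal (?M x) = (nn_kernel_op ^^ n) (\<lambda>y. ennreal (?M y)) x"
      using ennreal_kernel_op_power[OF kernel_op_limit_id_dominated x]
        kernel_op_power_fixed_point[OF kernel_op_limit_fixed_point[symmetric] kernel_op_limit_id_dominated x]
      by simp
    also have "\<dots> \<le> (nn_kernel_op ^^ n) (\<lambda>z. ennreal q * ennreal z + ennreal y * 1) x"
    proof (rule nn_kernel_op_power_mono[OF x])
      fix z assume "z \<ge> x"
      with x have z: "z > 0"
        by simp
      \<comment> \<open>Left of \<open>y\<close> the limit function is at most \<open>z\<close>,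
        hence at most \<open>y\<close>; from \<open>y\<close> on the assumption applies.\<close>
      have "?M z \<le> q * z + y"
        using le[of z] M(2)[OF z] q z \<open>y > 0\<close> mult_nonneg_nonneg[of q z] by (cases "z \<ge> y") (simp, linarith)
      then show "ennreal (?M z) \<le> ennreal q * ennreal z + ennreal y * 1"
        using q z \<open>y > 0\<close> by (simp add: ennreal_mult[symmetric] ennreal_plus[symmetric] ennreal_leI del: ennreal_plus)
    qed
    also have "\<dots> = ennreal q * (nn_kernel_op ^^ n) ennreal x + ennreal y * ?v n"
      by (rule nn_kernel_op_power_linear[OF x]) (auto intro!: measurable_restrict_space1)
    also have "(nn_kernel_op ^^ n) ennreal x = ennreal (?I n)"
      using ennreal_kernel_op_power[OF id_in_id_dominated x] by simp
    also have "?v n = ennreal (enn2real (?v n))"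
      using nn_kernel_op_power_one_le[OF x, of n] by (intro ennreal_enn2real[symmetric] le_less_trans[OF _ ennreal_one_less_top])
    finally have "ennreal (?M x) \<le> ennreal (q * ?I n + y * enn2real (?v n))"
      using q I \<open>y > 0\<close> by (simp add: ennreal_mult[symmetric] ennreal_plus[symmetric] del: ennreal_plus)
    then show ?thesis
      using q I \<open>y > 0\<close> by (subst (asm) ennreal_le_iff) auto
  qed
  moreover have "(\<lambda>n. q * ?I n + y * enn2real (?v n)) \<longlonglongrightarrow> q * ?M x + y * 0"
    by (intro tendsto_intros kernel_op_power_id_tendsto nn_kernel_op_power_one_tendsto x)
  ultimately have "?M x \<le> q * ?M x + y * 0"
    by (intro LIMSEQ_le_const) auto
  then have "(1 - q) * ?M x \<le> 0"
    by (simp add: algebra_simps)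
  with q M(1)[OF x] show ?thesis
    by (simp add: mult_le_0_iff)
qed

text \<open>The ratio is below 1 everywhere. A limsup below 1 would leave room for a factor
  \<open>q < 1\<close> near infinity and so force the limit function to vanish.\<close>

lemma Limsup_kernel_op_limit:
  assumes "x > 0" "kernel_op_limit x \<noteq> 0"
  shows "Limsup at_top (\<lambda>x. ereal (kernel_op_limit x / x)) = 1"
proof (rule antisym)
  let ?r = "\<lambda>x. ereal (kernel_op_limit x / x)"
  show "Limsup at_top ?r \<le> 1"
    using kernel_op_limit_less
    by (intro Limsup_bounded eventually_mono[OF eventually_gt_at_top[of 0]]) (auto simp: less_imp_le)
  show "1 \<le> Limsup at_top ?r"
  proof (rule ccontr)
    assume "\<not> 1 \<le> Limsup at_top ?r"
    then obtain q where q: "Limsup at_top ?r < ereal q" "ereal q < 1"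
      using ereal_dense2[of "Limsup at_top ?r" 1] by (auto simp: not_le)
    from Limsup_lessD[OF q(1)] eventually_gt_at_top[of 0]
    have "eventually (\<lambda>z. kernel_op_limit z \<le> q * z) at_top"
      by eventually_elim (simp add: field_simps less_imp_le)
    then obtain y where y: "\<And>z. z \<ge> y \<Longrightarrow> kernel_op_limit z \<le> q * z"
      by (auto simp: eventually_at_top_linorder)
    have "kernel_op_limit x = 0"
    \<comment> \<open>The density argument does not give a nonnegative \<open>q\<close>, nor the
      eventual bound a positive \<open>y\<close>; both maxima repair this.\<close>
    proof (rule kernel_op_limit_eq_0[of "max q 0" "max y 1"])
      show "kernel_op_limit z \<le> max q 0 * z" if "z \<ge> max y 1" for z
        using y[of z] that mult_right_mono[of q "max q 0" z] by linarith
    qed (use q assms in auto)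
    with assms(2) show False
      by simp
  qed
qed

end

subsection \<open>Increasing paths of the Markov chain\<close>

locale markov_martingale = positive_martingale_kernel K for K +
  fixes x :: real and P :: "'w measure" and S :: "nat \<Rightarrow> 'w \<Rightarrow> real"
  assumes start_pos: "x > 0" and markov_chain: "markov_chain K x P S"

sublocale markov_martingale \<subseteq> prob_space P
  using markov_chain by (simp add: markov_chain_def)

context markov_martingale
begin

lemma measurable_chain [measurable]: "S n \<in> P \<rightarrow>\<^sub>M pos_borel"
  using markov_chain by (simp add: markov_chain_def)

lemma measurable_chain_borel [measurable]: "S n \<in> borel_measurable P"
  using measurable_chain[of n] by (rule measurable_compose) (auto intro!: measurable_restrict_space1)

lemma chain_pos: "\<omega> \<in> space P \<Longrightarrow> S n \<omega> > 0"
  using measurable_space[OF measurable_chain] by (auto simp: space_restrict_space)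

lemma AE_start: "AE \<omega> in P. S 0 \<omega> = x"
  using markov_chain by (simp add: markov_chain_def)

section \<open>The history of the chain and the Markov property\<close>

abbreviation history :: "nat \<Rightarrow> 'w measure" where
  "history \<equiv> natural_filtration P S"

lemma space_history [simp]: "space (history n) = space P"
  by (simp add: natural_filtration_def space_measure_of_conv)

lemma sets_history:
  "sets (history n) = sigma_sets (space P) {S k -` B \<inter> space P | k B. k \<le> n \<and> B \<in> sets pos_borel}"
  unfolding natural_filtration_def by (rule sets_measure_of) auto

lemma subalgebra_history: "subalgebra P (history n)"
  unfolding subalgebra_def sets_history
  using measurable_sets[OF measurable_chain] by (auto intro!: sets.sigma_sets_subset)

lemma measurable_chain_history:
  assumes "k \<le> n"
  shows "S k \<in> history n \<rightarrow>\<^sub>M pos_borel" "S k \<in> borel_measurable (history n)"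
proof -
  show "S k \<in> history n \<rightarrow>\<^sub>M pos_borel"
    using assms measurable_space[OF measurable_chain]
    by (intro measurableI) (auto simp: sets_history intro!: sigma_sets.Basic)
  then show "S k \<in> borel_measurable (history n)"
    by (rule measurable_compose) (auto intro!: measurable_restrict_space1)
qed

text \<open>Integrating the conditional probability of \<open>markov_chain\<close> over an event of
  the history removes the conditional expectation.\<close>

lemma emeasure_history_step:
  assumes G: "G \<in> sets (history n)" and B: "B \<in> sets pos_borel"
  shows "emeasure P (G \<inter> S (Suc n) -` B) = (\<integral>\<^sup>+\<omega>. indicator G \<omega> * emeasure (K (S n \<omega>)) B \<partial>P)"
proof -
  interpret finite_measure_subalgebra P "history n"
    by unfold_locales (rule subalgebra_history)
  let ?E = "{\<omega>\<in>space P. S (Suc n) \<omega> \<in> B}"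
  have GP [measurable]: "G \<in> sets P"
    using G subalgebra_history by (auto simp: subalgebra_def)
  have "?E = S (Suc n) -` B \<inter> space P"
    by auto
  with measurable_sets[OF measurable_chain B] have E [measurable]: "?E \<in> sets P"
    by simp
  have [measurable]: "(\<lambda>\<omega>. measure (K (S n \<omega>)) B) \<in> borel_measurable P"
    by (rule measurable_compose[OF measurable_chain
          measurable_compose[OF measurable_kernel_prob measurable_measure_prob_algebra[OF B]]])
  have le1: "measure (K (S n \<omega>)) B \<le> 1" if "\<omega> \<in> space P" for \<omega>
    using prob_space.prob_le_1[OF prob_space_kernel[OF chain_pos[OF that]]] .
  have int: "integrable P (\<lambda>\<omega>. indicator G \<omega> * measure (K (S n \<omega>)) B)"
    by (rule integrable_const_bound[where B = 1])
      (auto split: split_indicator simp: le1 intro!: AE_I2)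
  have AE: "AE \<omega> in P. real_cond_exp P (history n) (indicator ?E) \<omega> = measure (K (S n \<omega>)) B"
    using markov_chain B unfolding markov_chain_def by blast
  have GE: "G \<inter> S (Suc n) -` B = G \<inter> ?E"
    using sets.sets_into_space[OF GP] by auto
  have "prob (G \<inter> ?E) = (\<integral>\<omega>\<in>G. indicator ?E \<omega> \<partial>P)"
    by (simp add: set_lebesgue_integral_def indicator_inter_arith[symmetric])
  also have "\<dots> = (\<integral>\<omega>\<in>G. real_cond_exp P (history n) (indicator ?E) \<omega> \<partial>P)"
    by (rule real_cond_exp_intA[OF _ G]) (simp add: E less_top[symmetric])
  also have "\<dots> = (LINT \<omega>|P. indicator G \<omega> * measure (K (S n \<omega>)) B)"
    unfolding set_lebesgue_integral_def
    by (intro integral_cong_AE) (use AE in \<open>auto elim!: eventually_mono\<close>)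
  finally have "emeasure P (G \<inter> S (Suc n) -` B) =
      ennreal (LINT \<omega>|P. indicator G \<omega> * measure (K (S n \<omega>)) B)"
    by (simp add: emeasure_eq_measure GE)
  also have "\<dots> = (\<integral>\<^sup>+\<omega>. ennreal (indicator G \<omega> * measure (K (S n \<omega>)) B) \<partial>P)"
    by (rule nn_integral_eq_integral[OF int, symmetric]) auto
  also have "\<dots> = (\<integral>\<^sup>+\<omega>. indicator G \<omega> * emeasure (K (S n \<omega>)) B \<partial>P)"
    by (intro nn_integral_cong)
      (auto split: split_indicator simp: finite_measure.emeasure_eq_measure
        prob_space.finite_measure[OF prob_space_kernel[OF chain_pos]])
  finally show ?thesis .
qed

text \<open>For rectangles this is \<open>emeasure_history_step\<close>. They generate the product
  and are stable under intersection, so they determine the joint law of two consecutive states on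
  \<open>G\<close>.\<close>

lemma nn_integral_markov:
  assumes G: "G \<in> sets (history n)"
    and g: "case_prod g \<in> borel_measurable (pos_borel \<Otimes>\<^sub>M pos_borel)"
  shows "(\<integral>\<^sup>+\<omega>. indicator G \<omega> * g (S n \<omega>) (S (Suc n) \<omega>) \<partial>P) =
    (\<integral>\<^sup>+\<omega>. indicator G \<omega> * (\<integral>\<^sup>+y. g (S n \<omega>) y \<partial>K (S n \<omega>)) \<partial>P)"
proof -
  let ?B = "pos_borel \<Otimes>\<^sub>M pos_borel"
  \<comment> \<open>\<open>N\<close> restricts \<open>P\<close> to \<open>G\<close>,
    \<open>\<kappa>\<close> pairs the current state with a next one drawn from the kernel, and
    \<open>\<mu>\<close> is the actual joint law on \<open>G\<close>. The claim reduces to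
    \<open>\<mu> = N \<bind> \<kappa>\<close>.\<close>
  define N where "N = density P (indicator G :: 'w \<Rightarrow> ennreal)"
  define \<kappa> where "\<kappa> \<omega> = distr (K (S n \<omega>)) ?B (Pair (S n \<omega>))" for \<omega>
  define \<mu> where "\<mu> = distr N ?B (\<lambda>\<omega>. (S n \<omega>, S (Suc n) \<omega>))"
  have GP [measurable]: "G \<in> sets P"
    using G subalgebra_history by (auto simp: subalgebra_def)
  have [measurable_cong, simp]: "sets N = sets P" and [simp]: "space N = space P"
    by (auto simp: N_def)
  have pos: "S n \<omega> \<in> space pos_borel" if "\<omega> \<in> space P" for \<omega>
    using chain_pos[OF that] by (simp add: space_restrict_space)
  have KS [measurable]: "(\<lambda>\<omega>. K (S n \<omega>)) \<in> P \<rightarrow>\<^sub>M subprob_algebra pos_borel"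
    by (rule measurable_compose[OF measurable_chain measurable_kernel_subprob])
  have \<kappa> [measurable]: "\<kappa> \<in> N \<rightarrow>\<^sub>M subprob_algebra ?B"
    unfolding \<kappa>_def[abs_def] by (rule measurable_distr2[where M = pos_borel]) measurable
  have Pair: "Pair (S n \<omega>) \<in> K (S n \<omega>) \<rightarrow>\<^sub>M ?B" if "\<omega> \<in> space P" for \<omega>
    by (intro measurable_on_kernel chain_pos that measurable_Pair1' pos)
  have "\<mu> = N \<bind> \<kappa>"
  proof (rule measure_eqI_generator_eq[OF Int_stable_pair_measure_generator[of pos_borel pos_borel]])
    show "sets \<mu> = sigma_sets (space pos_borel \<times> space pos_borel)
        {a \<times> b |a b. a \<in> sets pos_borel \<and> b \<in> sets pos_borel}"
      by (simp add: \<mu>_def sets_pair_measure)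
    have "sets (N \<bind> \<kappa>) = sets ?B"
      by (rule sets_bind_measurable[OF \<kappa>]) (simp add: not_empty)
    then show "sets (N \<bind> \<kappa>) = sigma_sets (space pos_borel \<times> space pos_borel)
        {a \<times> b |a b. a \<in> sets pos_borel \<and> b \<in> sets pos_borel}"
      by (simp add: sets_pair_measure)
    fix X assume "X \<in> {a \<times> b |a b. a \<in> sets pos_borel \<and> b \<in> sets pos_borel}"
    then obtain a b where X: "X = a \<times> b" and [measurable]: "a \<in> sets pos_borel" "b \<in> sets pos_borel"
      by blast
    \<comment> \<open>The condition on the current state is itself an event of the history, so it is
      absorbed into \<open>G\<close> and the one-step formula applies to \<open>b\<close>.\<close>
    let ?G = "G \<inter> (S n -` a \<inter> space P)"
    have G': "?G \<in> sets (history n)"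
      using measurable_sets[OF measurable_chain_history(1)[of n n] \<open>a \<in> _\<close>] G by auto
    have XB: "X \<in> sets ?B"
      by (simp add: X)
    have "emeasure \<mu> X = emeasure N ((\<lambda>\<omega>. (S n \<omega>, S (Suc n) \<omega>)) -` X \<inter> space P)"
      unfolding \<mu>_def using XB by (subst emeasure_distr) auto
    also have "\<dots> = emeasure P (G \<inter> ((\<lambda>\<omega>. (S n \<omega>, S (Suc n) \<omega>)) -` X \<inter> space P))"
      unfolding N_def using XB by (subst emeasure_density)
        (auto simp: nn_integral_indicator[symmetric] indicator_inter_arith simp del: nn_integral_indicator)
    also have "G \<inter> ((\<lambda>\<omega>. (S n \<omega>, S (Suc n) \<omega>)) -` X \<inter> space P) = ?G \<inter> S (Suc n) -` b"
      by (auto simp: X)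
    also have "emeasure P \<dots> = (\<integral>\<^sup>+\<omega>. indicator ?G \<omega> * emeasure (K (S n \<omega>)) b \<partial>P)"
      by (rule emeasure_history_step[OF G']) measurable
    also have "\<dots> = (\<integral>\<^sup>+\<omega>. indicator G \<omega> * emeasure (\<kappa> \<omega>) X \<partial>P)"
    proof (intro nn_integral_cong)
      fix \<omega> assume \<omega>: "\<omega> \<in> space P"
      have "emeasure (\<kappa> \<omega>) X = emeasure (K (S n \<omega>)) (Pair (S n \<omega>) -` X \<inter> space (K (S n \<omega>)))"
        unfolding \<kappa>_def by (rule emeasure_distr[OF Pair[OF \<omega>] XB])
      also have "Pair (S n \<omega>) -` X \<inter> space (K (S n \<omega>)) = (if S n \<omega> \<in> a then b else {})"
        using sets.sets_into_space[of b "K (S n \<omega>)"]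
        by (auto simp: X sets_kernel chain_pos[OF \<omega>])
      finally show "indicator ?G \<omega> * emeasure (K (S n \<omega>)) b = indicator G \<omega> * emeasure (\<kappa> \<omega>) X"
        using \<omega> by (auto split: split_indicator)
    qed
    also have "\<dots> = (\<integral>\<^sup>+\<omega>. emeasure (\<kappa> \<omega>) X \<partial>N)"
      unfolding N_def
      by (rule nn_integral_density[symmetric])
        (use measurable_emeasure_kernel[OF \<kappa> XB] in \<open>auto cong: measurable_cong_sets\<close>)
    also have "\<dots> = emeasure (N \<bind> \<kappa>) X"
      by (rule emeasure_bind[OF _ \<kappa> XB, symmetric]) (simp add: not_empty)
    finally show "emeasure \<mu> X = emeasure (N \<bind> \<kappa>) X" .
  next
    \<comment> \<open>The whole space is a rectangle, so a constant sequence exhausts it, and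
      \<open>\<mu>\<close> is finite.\<close>
    show "range (\<lambda>_::nat. space pos_borel \<times> space pos_borel)
        \<subseteq> {a \<times> b |a b. a \<in> sets pos_borel \<and> b \<in> sets pos_borel}"
      by blast
    have "finite_measure N"
      unfolding N_def by (rule finite_measureI) (simp add: emeasure_density emeasure_eq_measure)
    then have "finite_measure \<mu>"
      unfolding \<mu>_def by (rule finite_measure.finite_measure_distr) measurable
    then show "emeasure \<mu> (space pos_borel \<times> space pos_borel) \<noteq> \<infinity>"
      by (simp add: finite_measure.emeasure_finite)
  next
    show "{a \<times> b |a b. a \<in> sets pos_borel \<and> b \<in> sets pos_borel}
        \<subseteq> Pow (space pos_borel \<times> space pos_borel)"
      using sets.sets_into_space by fast
  qed auto
  moreover have "(\<integral>\<^sup>+z. case_prod g z \<partial>\<mu>) =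
      (\<integral>\<^sup>+\<omega>. indicator G \<omega> * g (S n \<omega>) (S (Suc n) \<omega>) \<partial>P)"
    unfolding \<mu>_def N_def using g by (subst nn_integral_distr) (auto simp: nn_integral_density)
  moreover have "(\<integral>\<^sup>+z. case_prod g z \<partial>(N \<bind> \<kappa>)) =
      (\<integral>\<^sup>+\<omega>. indicator G \<omega> * (\<integral>\<^sup>+z. case_prod g z \<partial>\<kappa> \<omega>) \<partial>P)"
  proof -
    have "(\<lambda>\<omega>. \<integral>\<^sup>+z. case_prod g z \<partial>\<kappa> \<omega>) \<in> borel_measurable N"
      by (rule measurable_compose[OF \<kappa> nn_integral_measurable_subprob_algebra[OF g]])
    then show ?thesis
      unfolding nn_integral_bind[OF g \<kappa>]
      by (simp add: N_def nn_integral_density)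
  qed
  moreover have "(\<integral>\<^sup>+\<omega>. indicator G \<omega> * (\<integral>\<^sup>+z. case_prod g z \<partial>\<kappa> \<omega>) \<partial>P) =
      (\<integral>\<^sup>+\<omega>. indicator G \<omega> * (\<integral>\<^sup>+y. g (S n \<omega>) y \<partial>K (S n \<omega>)) \<partial>P)"
  proof (intro nn_integral_cong arg_cong2[where f = "(*)"] refl)
    fix \<omega> assume "\<omega> \<in> space P"
    then show "(\<integral>\<^sup>+z. case_prod g z \<partial>\<kappa> \<omega>) = (\<integral>\<^sup>+y. g (S n \<omega>) y \<partial>K (S n \<omega>))"
      unfolding \<kappa>_def using g by (simp add: nn_integral_distr[OF Pair])
  qed
  ultimately show ?thesis
    by simp
qed

text \<open>Starting the comparison at \<open>S 0\<close> instead of \<open>x\<close> makes all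
  steps alike, as the induction on \<open>n\<close> requires.\<close>

definition climb :: "nat \<Rightarrow> 'w set" where
  "climb n = {\<omega>\<in>space P. \<forall>k<n. S k \<omega> \<le> S (Suc k) \<omega>}"

lemma sets_climb_history: "climb n \<in> sets (history n)"
proof -
  have "{\<omega>\<in>space (history n). \<forall>k\<in>{..<n}. S k \<omega> \<le> S (Suc k) \<omega>} \<in> sets (history n)"
  proof (rule sets.sets_Collect_finite_All)
    fix k assume "k \<in> {..<n}"
    then show "{\<omega>\<in>space (history n). S k \<omega> \<le> S (Suc k) \<omega>} \<in> sets (history n)"
      by (intro borel_measurable_le measurable_chain_history(2)) auto
  qed simp
  also have "{\<omega>\<in>space (history n). \<forall>k\<in>{..<n}. S k \<omega> \<le> S (Suc k) \<omega>} = climb n"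
    by (auto simp: climb_def)
  finally show ?thesis .
qed

lemma sets_climb [measurable]: "climb n \<in> sets P"
  using sets_climb_history subalgebra_history unfolding subalgebra_def by blast

text \<open>The Markov property integrates out the last step, replacing \<open>f\<close> by
  \<open>nn_kernel_op f\<close> and \<open>n + 1\<close> by \<open>n\<close>; hence the induction
  over arbitrary \<open>f\<close>.\<close>

lemma nn_integral_climb:
  assumes [measurable]: "f \<in> borel_measurable pos_borel"
  shows "(\<integral>\<^sup>+\<omega>. indicator (climb n) \<omega> * f (S n \<omega>) \<partial>P) = (nn_kernel_op ^^ n) f x"
  using assms
proof (induction n arbitrary: f)
  case 0
  have "(\<integral>\<^sup>+\<omega>. indicator (climb 0) \<omega> * f (S 0 \<omega>) \<partial>P) = (\<integral>\<^sup>+\<omega>. f x \<partial>P)"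
    using AE_start by (intro nn_integral_cong_AE) (auto simp: climb_def elim!: eventually_mono)
  then show ?case
    by (simp add: emeasure_space_1)
next
  case (Suc n)
  note [measurable] = Suc.prems
  let ?g = "\<lambda>s y. indicator {s..} y * f y"
  have "case_prod (\<lambda>s y. if s \<le> y then f y else 0) \<in> borel_measurable (pos_borel \<Otimes>\<^sub>M pos_borel)"
    by (unfold split_beta') measurable
  also have "(\<lambda>s y. if s \<le> y then f y else 0) = ?g"
    by (auto simp: fun_eq_iff split: split_indicator)
  finally have g: "case_prod ?g \<in> borel_measurable (pos_borel \<Otimes>\<^sub>M pos_borel)" .
  have "(\<integral>\<^sup>+\<omega>. indicator (climb (Suc n)) \<omega> * f (S (Suc n) \<omega>) \<partial>P) =
      (\<integral>\<^sup>+\<omega>. indicator (climb n) \<omega> * ?g (S n \<omega>) (S (Suc n) \<omega>) \<partial>P)"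
    by (intro nn_integral_cong) (auto simp: climb_def less_Suc_eq split: split_indicator)
  also have "\<dots> = (\<integral>\<^sup>+\<omega>. indicator (climb n) \<omega> * nn_kernel_op f (S n \<omega>) \<partial>P)"
    unfolding nn_kernel_op_def by (rule nn_integral_markov[OF sets_climb_history g])
  also have "\<dots> = (nn_kernel_op ^^ n) (nn_kernel_op f) x"
    by (rule Suc.IH) measurable
  finally show ?case
    by (simp only: funpow_Suc_right o_apply)
qed

section \<open>Integrability of the chain and of its limit\<close>

lemma nn_integral_chain: "(\<integral>\<^sup>+\<omega>. ennreal (S n \<omega>) \<partial>P) = ennreal x"
proof (induction n)
  case 0
  have "(\<integral>\<^sup>+\<omega>. ennreal (S 0 \<omega>) \<partial>P) = (\<integral>\<^sup>+\<omega>. ennreal x \<partial>P)"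
    using AE_start by (intro nn_integral_cong_AE) (auto elim!: eventually_mono)
  then show ?case
    by (simp add: emeasure_space_1)
next
  case (Suc n)
  have "(\<integral>\<^sup>+\<omega>. ennreal (S (Suc n) \<omega>) \<partial>P) = (\<integral>\<^sup>+\<omega>. indicator (space P) \<omega> * ennreal (S (Suc n) \<omega>) \<partial>P)"
    by (intro nn_integral_cong) auto
  also have "\<dots> = (\<integral>\<^sup>+\<omega>. indicator (space P) \<omega> * (\<integral>\<^sup>+y. ennreal y \<partial>K (S n \<omega>)) \<partial>P)"
    by (rule nn_integral_markov) (use sets.top[of "history n"] in \<open>auto simp: split_beta'\<close>)
  also have "\<dots> = (\<integral>\<^sup>+\<omega>. ennreal (S n \<omega>) \<partial>P)"
    by (intro nn_integral_cong) (simp add: nn_integral_kernel_id chain_pos)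
  finally show ?case
    by (simp add: Suc)
qed

lemma integrable_chain: "integrable P (S n)"
  by (rule integrableI_nonneg)
    (auto simp: nn_integral_chain chain_pos intro!: AE_I2 less_imp_le)

text \<open>Fatou's lemma suffices: almost sure convergence of the paths is not involved, because on the
  set of divergence \<open>lim\<close> is a constant.\<close>

lemma integrable_S_limit: "integrable P (S_limit S)"
proof -
  \<comment> \<open>\<open>lim\<close> is a definite description, so all divergent paths receive the
    same unspecified value; \<open>c\<close> is its absolute value.\<close>
  define c where "c = \<bar>THE l::real. False\<bar>"
  have bound: "ennreal \<bar>S_limit S \<omega>\<bar> \<le> liminf (\<lambda>n. ennreal (S n \<omega>)) + ennreal c"
    if \<omega>: "\<omega> \<in> space P" for \<omega>
  proof (cases "convergent (\<lambda>n. S n \<omega>)")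
    case True
    then have l: "(\<lambda>n. S n \<omega>) \<longlonglongrightarrow> S_limit S \<omega>"
      by (simp add: S_limit_def convergent_LIMSEQ_iff)
    then have "S_limit S \<omega> \<ge> 0"
      using chain_pos[OF \<omega>] by (intro LIMSEQ_le_const) (auto simp: less_imp_le)
    moreover have "liminf (\<lambda>n. ennreal (S n \<omega>)) = ennreal (S_limit S \<omega>)"
      by (rule lim_imp_Liminf) (use l in \<open>auto intro: tendsto_ennrealI\<close>)
    ultimately show ?thesis
      by simp
  next
    case False
    then have "(\<lambda>l. (\<lambda>n. S n \<omega>) \<longlonglongrightarrow> l) = (\<lambda>l. False)"
      by (auto simp: convergent_def)
    then have "\<bar>S_limit S \<omega>\<bar> = c"
      by (simp add: S_limit_def lim_def c_def)
    then show ?thesis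
      by simp
  qed
  have [measurable]: "S_limit S \<in> borel_measurable P"
    unfolding S_limit_def[abs_def] by measurable
  have "(\<integral>\<^sup>+\<omega>. ennreal (norm (S_limit S \<omega>)) \<partial>P) \<le>
      (\<integral>\<^sup>+\<omega>. liminf (\<lambda>n. ennreal (S n \<omega>)) + ennreal c \<partial>P)"
    using bound by (intro nn_integral_mono) simp
  also have "\<dots> = (\<integral>\<^sup>+\<omega>. liminf (\<lambda>n. ennreal (S n \<omega>)) \<partial>P) + ennreal c"
    by (simp add: nn_integral_add emeasure_space_1)
  also have "\<dots> \<le> liminf (\<lambda>n. \<integral>\<^sup>+\<omega>. ennreal (S n \<omega>) \<partial>P) + ennreal c"
    by (intro add_right_mono nn_integral_liminf) measurable
  also have "\<dots> < \<infinity>"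
    by (simp add: nn_integral_chain Liminf_const)
  finally show ?thesis
    by (intro integrableI_bounded) auto
qed

text \<open>The case of the identity in \<open>nn_integral_climb\<close>, moved to the reals by
  nonnegativity of both sides.\<close>

lemma integral_climb_chain:
  "(LINT \<omega>|P. indicator (climb n) \<omega> * S n \<omega>) = (kernel_op K ^^ n) (\<lambda>x. x) x"
proof -
  have nonneg: "AE \<omega> in P. 0 \<le> indicator (climb n) \<omega> * S n \<omega>"
    using chain_pos by (auto split: split_indicator intro!: AE_I2 less_imp_le)
  have "ennreal (LINT \<omega>|P. indicator (climb n) \<omega> * S n \<omega>) =
      (\<integral>\<^sup>+\<omega>. indicator (climb n) \<omega> * ennreal (S n \<omega>) \<partial>P)"
    using integrable_mult_indicator[OF sets_climb integrable_chain, of n n]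
    by (subst nn_integral_eq_integral[symmetric, OF _ nonneg])
      (auto intro!: nn_integral_cong split: split_indicator)
  also have "\<dots> = ennreal ((kernel_op K ^^ n) (\<lambda>x. x) x)"
    using ennreal_kernel_op_power[OF id_in_id_dominated start_pos, of n]
    by (simp add: nn_integral_climb measurable_restrict_space1)
  finally show ?thesis
    using kernel_op_power_id_dominated[OF id_in_id_dominated, of n] start_pos
      integral_nonneg_AE[OF nonneg] by (simp add: id_dominated_def)
qed

text \<open>The events differ only in \<open>S 0\<close> versus \<open>x\<close>. At
  \<open>n = 0\<close> this would fail: \<open>increasing_event\<close> still asks for
  \<open>x \<le> S 1\<close>, whereas \<open>climb 0\<close> is the whole space.\<close>

lemma indicator_increasing_event:
  assumes "n \<ge> 1"
  shows "AE \<omega> in P. indicator (increasing_event S x n) \<omega> = (indicator (climb n) \<omega> :: real)"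
  using AE_start
proof (rule AE_mp, intro AE_I2 impI)
  fix \<omega> assume \<omega>: "\<omega> \<in> space P" and "S 0 \<omega> = x"
  have "{..<n} = insert 0 {1..<n}"
    using assms by auto
  then have "(\<forall>k\<in>{..<n}. S k \<omega> \<le> S (Suc k) \<omega>) \<longleftrightarrow>
      S 0 \<omega> \<le> S 1 \<omega> \<and> (\<forall>k\<in>{1..<n}. S k \<omega> \<le> S (Suc k) \<omega>)"
    by simp
  then have "\<omega> \<in> increasing_event S x n \<longleftrightarrow> \<omega> \<in> climb n"
    using \<omega> \<open>S 0 \<omega> = x\<close> by (auto simp: increasing_event_def climb_def)
  then show "indicator (increasing_event S x n) \<omega> = (indicator (climb n) \<omega> :: real)"
    by (simp add: indicator_def)
qed

text \<open>Translates the hypothesis on \<open>a\<close>, which speaks of the chain, into one on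
  the kernel; positivity of the chain supplies the lower end of the interval.\<close>

lemma prob_step_down: "prob {\<omega>\<in>space P. S 1 \<omega> < x} = measure (K x) {0<..<x}"
proof -
  have B: "{0<..<x} \<in> sets pos_borel"
    by (auto simp: sets_restrict_space_iff)
  have "{\<omega>\<in>space P. S 1 \<omega> < x} = space P \<inter> S (Suc 0) -` {0<..<x}"
    using chain_pos by auto
  also have "emeasure P \<dots> = (\<integral>\<^sup>+\<omega>. indicator (space P) \<omega> * emeasure (K (S 0 \<omega>)) {0<..<x} \<partial>P)"
    by (rule emeasure_history_step[OF _ B]) (use sets.top[of "history 0"] in simp)
  also have "\<dots> = (\<integral>\<^sup>+\<omega>. emeasure (K x) {0<..<x} \<partial>P)"
  proof (rule nn_integral_cong_AE)
    show "AE \<omega> in P. indicator (space P) \<omega> * emeasure (K (S 0 \<omega>)) {0<..<x} = emeasure (K x) {0<..<x}"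
      using AE_start AE_space by eventually_elim simp
  qed
  finally show ?thesis
    by (simp add: measure_def emeasure_space_1)
qed

end

section \<open>Passage to the limit in the default function\<close>

locale downward_markov_martingale = markov_martingale K x P S + downward_martingale_kernel K
  for K x and P :: "'w measure" and S
begin

lemma prob_climb_tendsto: "(\<lambda>n. prob (climb n)) \<longlonglongrightarrow> 0"
proof -
  have "emeasure P (climb n) = (nn_kernel_op ^^ n) (\<lambda>_. 1) x" for n
    using nn_integral_climb[of "\<lambda>_. 1" n] by simp
  then show ?thesis
    using nn_kernel_op_power_one_tendsto[OF start_pos] by (simp add: measure_def)
qed

text \<open>Almost every path eventually leaves the decreasing events \<open>climb n\<close>, and
  the integrable \<open>S_limit\<close> dominates.\<close>

lemma integral_climb_S_limit_tendsto:
  "(\<lambda>n. LINT \<omega>|P. indicator (climb n) \<omega> * S_limit S \<omega>) \<longlonglongrightarrow> 0"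
proof -
  have "AE \<omega> in P. \<omega> \<notin> (\<Inter>n. climb n)"
  proof (rule AE_not_in, rule null_setsI)
    have "prob (\<Inter>n. climb n) \<le> prob (climb m)" for m
      by (intro finite_measure_mono) auto
    then have "prob (\<Inter>n. climb n) \<le> 0"
      by (intro LIMSEQ_le_const[OF prob_climb_tendsto]) auto
    then show "emeasure P (\<Inter>n. climb n) = 0"
      by (simp add: emeasure_eq_measure measure_le_0_iff)
  qed measurable
  then have "AE \<omega> in P. (\<lambda>n. indicator (climb n) \<omega> * S_limit S \<omega>) \<longlonglongrightarrow> 0"
  proof eventually_elim
    case (elim \<omega>)
    then obtain m where "\<omega> \<notin> climb m"
      by auto
    then have "\<omega> \<notin> climb n" if "n \<ge> m" for n
      using that by (auto simp: climb_def intro: less_le_trans)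
    then have "eventually (\<lambda>n. indicator (climb n) \<omega> * S_limit S \<omega> = 0) sequentially"
      by (intro eventually_sequentiallyI[of m]) simp
    then show ?case
      by (rule tendsto_eventually)
  qed
  then have "(\<lambda>n. LINT \<omega>|P. indicator (climb n) \<omega> * S_limit S \<omega>) \<longlonglongrightarrow> (LINT \<omega>|P. 0)"
  proof (rule integral_dominated_convergence[rotated 3])
    show "integrable P (\<lambda>\<omega>. \<bar>S_limit S \<omega>\<bar>)"
      using integrable_S_limit by (rule integrable_abs)
    show "AE \<omega> in P. norm (indicator (climb n) \<omega> * S_limit S \<omega>) \<le> \<bar>S_limit S \<omega>\<bar>" for n
      by (rule AE_I2) (simp split: split_indicator)
    show "(\<lambda>\<omega>. indicator (climb n) \<omega> * S_limit S \<omega>) \<in> borel_measurable P" for n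
      using borel_measurable_integrable[OF integrable_S_limit] by measurable
  qed simp
  then show ?thesis
    by simp
qed

text \<open>The \<open>S n\<close> part of the expectation is exactly an iterate of the kernel
  operator, while the \<open>S_limit\<close> part vanishes in the limit.\<close>

lemma default_integral_tendsto:
  "(\<lambda>n. LINT \<omega>|P. (S n \<omega> - S_limit S \<omega>) * indicator (increasing_event S x n) \<omega>)
    \<longlonglongrightarrow> kernel_op_limit x"
proof -
  have int: "integrable P (\<lambda>\<omega>. indicator (climb n) \<omega> * S n \<omega>)"
    "integrable P (\<lambda>\<omega>. indicator (climb n) \<omega> * S_limit S \<omega>)" for n
    using integrable_mult_indicator[OF sets_climb integrable_chain]
      integrable_mult_indicator[OF sets_climb integrable_S_limit] by auto
  have "(LINT \<omega>|P. (S n \<omega> - S_limit S \<omega>) * indicator (increasing_event S x n) \<omega>) =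
      (kernel_op K ^^ n) (\<lambda>x. x) x - (LINT \<omega>|P. indicator (climb n) \<omega> * S_limit S \<omega>)" if "n \<ge> 1" for n
  proof -
    \<comment> \<open>\<open>increasing_event\<close> is not confined to \<open>space P\<close>, so
      measurability is shown for its intersection with the space.\<close>
    have "{\<omega>\<in>space P. x \<le> S 1 \<omega> \<and> (\<forall>k\<in>{1..<n}. S k \<omega> \<le> S (Suc k) \<omega>)} \<in> sets P"
      by measurable
    also have "{\<omega>\<in>space P. x \<le> S 1 \<omega> \<and> (\<forall>k\<in>{1..<n}. S k \<omega> \<le> S (Suc k) \<omega>)} =
        increasing_event S x n \<inter> space P"
      by (auto simp: increasing_event_def)
    finally have [measurable]: "(indicator (increasing_event S x n) :: _ \<Rightarrow> real) \<in> borel_measurable P"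
      by (simp add: borel_measurable_indicator_iff)
    have [measurable]: "S_limit S \<in> borel_measurable P"
      using integrable_S_limit by simp
    have "(LINT \<omega>|P. (S n \<omega> - S_limit S \<omega>) * indicator (increasing_event S x n) \<omega>) =
        (LINT \<omega>|P. indicator (climb n) \<omega> * S n \<omega> - indicator (climb n) \<omega> * S_limit S \<omega>)"
    proof (rule integral_cong_AE)
      show "AE \<omega> in P. (S n \<omega> - S_limit S \<omega>) * indicator (increasing_event S x n) \<omega> =
          indicator (climb n) \<omega> * S n \<omega> - indicator (climb n) \<omega> * S_limit S \<omega>"
        using indicator_increasing_event[OF that] by eventually_elim (simp add: algebra_simps)
    qed measurable
    then show ?thesis
      by (simp add: int integral_climb_chain)
  qed
  \<comment> \<open>The identity starts at index 1, so it enters the limit only eventually.\<close>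
  then have ev: "eventually (\<lambda>n. (kernel_op K ^^ n) (\<lambda>x. x) x -
      (LINT \<omega>|P. indicator (climb n) \<omega> * S_limit S \<omega>) =
      (LINT \<omega>|P. (S n \<omega> - S_limit S \<omega>) * indicator (increasing_event S x n) \<omega>)) sequentially"
    by (intro eventually_sequentiallyI[of 1]) simp
  have lim: "(\<lambda>n. (kernel_op K ^^ n) (\<lambda>x. x) x - (LINT \<omega>|P. indicator (climb n) \<omega> * S_limit S \<omega>))
      \<longlonglongrightarrow> kernel_op_limit x - 0"
    by (intro tendsto_diff kernel_op_power_id_tendsto start_pos integral_climb_S_limit_tendsto)
  from Lim_transform_eventually[OF lim ev] show ?thesis
    by simp
qed

end

theorem theorem3p9:
  fixes K :: "real \<Rightarrow> real measure"
    and P :: "real \<Rightarrow> 'w measure"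
    and S :: "nat \<Rightarrow> 'w \<Rightarrow> real"
    and a M\<^sub>S :: "real \<Rightarrow> real"
  defines "a \<equiv> \<lambda>x. measure (P x) {\<omega>\<in>space (P x). S 1 \<omega> < x}"
    and "M\<^sub>S \<equiv> default_function P S"
  assumes "martingale_kernel K"
    and "\<And>x. x > 0 \<Longrightarrow> markov_chain K x (P x) S"
    and "\<And>x\<^sub>a y. 0 < x\<^sub>a \<Longrightarrow> x\<^sub>a < y \<Longrightarrow> (INF x\<in>{x\<^sub>a..y}. a x) > 0"
  shows "M\<^sub>S \<in> id_dominated \<and> (\<forall>x>0. M\<^sub>S x = kernel_op K M\<^sub>S x) \<and>
      (\<forall>M\<in>id_dominated. (\<forall>x>0. M x = kernel_op K M x) \<longrightarrow> (\<forall>x>0. M x \<le> M\<^sub>S x)) \<and>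
      (\<forall>x>0. M\<^sub>S x = kernel_op_infinity K (\<lambda>x. x) x) \<and>
      (\<forall>x>0. M\<^sub>S x < x) \<and>
      ((\<exists>x>0. M\<^sub>S x \<noteq> 0) \<longrightarrow> Limsup at_top (\<lambda>x. ereal (M\<^sub>S x / x)) = 1)"
proof -
  have markov: "markov_martingale K x (P x) S" if "x > 0" for x
    using assms(3,4) that by unfold_locales auto
  have a: "a x = measure (K x) {0<..<x}" if "x > 0" for x
    unfolding a_def by (rule markov_martingale.prob_step_down[OF markov[OF that]])
  interpret K: downward_martingale_kernel K
  proof unfold_locales
    show "\<exists>\<epsilon>>0. \<forall>z\<in>{u..v}. \<epsilon> \<le> measure (K z) {0<..<z}" if "0 < u" "u < v" for u v
    proof (intro exI conjI ballI)
      \<comment> \<open>The infimum itself serves as the uniform bound.\<close>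
      show "0 < (INF z\<in>{u..v}. a z)"
        using assms(5) that .
      fix z assume z: "z \<in> {u..v}"
      have "bdd_below (a ` {u..v})"
        by (rule bdd_belowI[of _ 0]) (auto simp: a_def)
      from cINF_lower[OF this z] show "(INF z\<in>{u..v}. a z) \<le> measure (K z) {0<..<z}"
        using z \<open>0 < u\<close> by (simp add: a)
    qed
  qed (rule assms(3))
  have M: "M\<^sub>S x = K.kernel_op_limit x" if "x > 0" for x
  proof -
    interpret markov_martingale K x "P x" S
      using markov that .
    interpret downward_markov_martingale K x "P x" S ..
    show ?thesis
      unfolding M\<^sub>S_def default_function_def by (rule limI[OF default_integral_tendsto])
  qed
  \<comment> \<open>\<open>M\<^sub>S\<close> and the limit function agree only at positive
    arguments; this suffices because \<open>K x\<close> lives there.\<close>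
  have op: "kernel_op K M\<^sub>S x = kernel_op K K.kernel_op_limit x" if "x > 0" for x
    unfolding kernel_op_def set_lebesgue_integral_def
    by (intro Bochner_Integration.integral_cong) (auto simp: K.space_kernel M that)
  have "M\<^sub>S \<in> borel_measurable pos_borel \<longleftrightarrow> K.kernel_op_limit \<in> borel_measurable pos_borel"
    by (intro measurable_cong) (simp add: space_restrict_space M)
  then have "M\<^sub>S \<in> id_dominated"
    using K.kernel_op_limit_id_dominated by (simp add: id_dominated_def M)
  moreover have "Limsup at_top (\<lambda>x. ereal (M\<^sub>S x / x)) =
      Limsup at_top (\<lambda>x. ereal (K.kernel_op_limit x / x))"
    by (intro Limsup_eq eventually_mono[OF eventually_gt_at_top[of 0]]) (simp add: M)
  then have "Limsup at_top (\<lambda>x. ereal (M\<^sub>S x / x)) = 1" if "\<exists>x>0. M\<^sub>S x \<noteq> 0"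
    using K.Limsup_kernel_op_limit that by (auto simp: M)
  ultimately show ?thesis
    using K.kernel_op_limit_fixed_point K.fixed_point_le_kernel_op_limit K.kernel_op_limit_less
    by (auto simp: M op)
qed

end
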